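(* Let $\Delta_1,\dots,\Delta_r$ be reflexive polytopes and let $\Delta=\prod_{k=1}^r\Delta_k$ be their product. Then the Mabuchi constants satisfy $$M_{X_\Delta}=M_{X_{\Delta_1}}+\cdots+M_{X_{\Delta_r}} .$$
   Context: A reflexive polytope is a full-dimensional lattice polytope $\Delta\subset\mathbb{R}^n$ (with respect to $\mathbb{Z}^n$) with $\mathbf{0}$ in its interior whose dual polytope is also a lattice polytope; $X_\Delta$ denotes the associated Gorenstein toric Fano variety. Let $dv$ be Lebesgue measure on $\mathbb{R}^n$. The Ricci affine function $\ell_\Delta$ is the unique affine function on $\mathbb{R}^n$ with $\int_\Delta\ell_\Delta u\,dv=u(\mathbf{0})$ for every affine function $u$ on $\mathbb{R}^n$. The potential function of $\Delta$ is $\theta_\Delta=1-\mathrm{vol}(\Delta)\,\ell_\Delta$, and the Mabuchi constant is $M_{X_\Delta}=\max_{\boldsymbol{x}\in\Delta}\theta_\Delta(\boldsymbol{x})$. The product of $\Delta_k\subset\mathbb{R}^{n_k}$ is taken in $\mathbb{R}^{n_1+\cdots+n_r}$. *)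

theory Defs
  imports "HOL-Analysis.Analysis"
begin

text \<open>
  The dimensions of the polytopes vary inside the statement, so the space of dimension \<open>n\<close> is
  the extensional function space below. It is the carrier both of the product topology and of the
  product measure, which are its Euclidean topology and its Lebesgue measure.
\<close>

type_synonym point = "nat \<Rightarrow> real"

definition real_space :: "nat \<Rightarrow> point set" where
  "real_space n = ({..<n} \<rightarrow>\<^sub>E UNIV)"

definition lattice_points :: "nat \<Rightarrow> point set" where
  "lattice_points n = ({..<n} \<rightarrow>\<^sub>E \<int>)"

definition origin :: "nat \<Rightarrow> point" where
  "origin n = (\<lambda>i\<in>{..<n}. 0)"

definition real_space_top :: "nat \<Rightarrow> point topology" where
  "real_space_top n = product_topology (\<lambda>_. euclideanreal) {..<n}"

definition leb :: "nat \<Rightarrow> point measure" where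
  "leb n = (\<Pi>\<^sub>M i\<in>{..<n}. lborel)"

definition conv_hull :: "nat \<Rightarrow> point set \<Rightarrow> point set" where
  "conv_hull n V = {(\<lambda>i\<in>{..<n}. \<Sum>v\<in>V. c v * v i) | c. (\<forall>v\<in>V. 0 \<le> c v) \<and> (\<Sum>v\<in>V. c v) = 1}"

definition lattice_polytope :: "nat \<Rightarrow> point set \<Rightarrow> bool" where
  "lattice_polytope n P \<longleftrightarrow> (\<exists>V. finite V \<and> V \<subseteq> lattice_points n \<and> P = conv_hull n V)"

text \<open>
  The sign convention is that of toric geometry. The other usual one (\<open>\<le> 1\<close>) gives the reflection
  of this set in the origin, hence the same reflexive polytopes.
\<close>

definition dual_polytope :: "nat \<Rightarrow> point set \<Rightarrow> point set" where
  "dual_polytope n P = {y \<in> real_space n. \<forall>x\<in>P. (\<Sum>i<n. x i * y i) \<ge> -1}"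

text \<open>Full-dimensionality is contained in the condition that the origin is an interior point.\<close>

definition reflexive_polytope :: "nat \<Rightarrow> point set \<Rightarrow> bool" where
  "reflexive_polytope n P \<longleftrightarrow>
     lattice_polytope n P \<and>
     origin n \<in> real_space_top n interior_of P \<and>
     lattice_polytope n (dual_polytope n P)"

text \<open>
  An affine function in this sense depends only on the coordinates below \<open>n\<close>, so it is determined,
  as a total function, by its values on \<open>real_space n\<close>; this makes the description in
  \<open>ricci_affine\<close> unique.
\<close>

definition affine_function :: "nat \<Rightarrow> (point \<Rightarrow> real) \<Rightarrow> bool" where
  "affine_function n u \<longleftrightarrow> (\<exists>a b. u = (\<lambda>x. a + (\<Sum>i<n. b i * x i)))"

definition ricci_affine :: "nat \<Rightarrow> point set \<Rightarrow> point \<Rightarrow> real" where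
  "ricci_affine n P = (THE l. affine_function n l \<and>
     (\<forall>u. affine_function n u \<longrightarrow> (LINT x:P|leb n. l x * u x) = u (origin n)))"

definition potential :: "nat \<Rightarrow> point set \<Rightarrow> point \<Rightarrow> real" where
  "potential n P x = 1 - measure (leb n) P * ricci_affine n P x"

definition mabuchi_constant :: "nat \<Rightarrow> point set \<Rightarrow> real" where
  "mabuchi_constant n P = (GREATEST m. m \<in> potential n P ` P)"

text \<open>
  The product of \<open>P 1, \<dots>, P r\<close>, with \<open>P k\<close> in dimension \<open>n k\<close>: points of the product are
  concatenations, and \<open>block n k\<close> reads off the \<open>k\<close>-th group of coordinates.
\<close>

definition block :: "(nat \<Rightarrow> nat) \<Rightarrow> nat \<Rightarrow> point \<Rightarrow> point" where
  "block n k x = (\<lambda>i\<in>{..<n k}. x ((\<Sum>j=1..<k. n j) + i))"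

definition product_polytope :: "nat \<Rightarrow> (nat \<Rightarrow> nat) \<Rightarrow> (nat \<Rightarrow> point set) \<Rightarrow> point set" where
  "product_polytope r n P = {x \<in> real_space (\<Sum>k=1..r. n k). \<forall>k\<in>{1..r}. block n k x \<in> P k}"

end

theory Submission
  imports Defs
begin

text \<open>
  Let \<open>V\<^sub>1\<close>, \<open>V\<^sub>2\<close> and \<open>l\<^sub>1\<close>, \<open>l\<^sub>2\<close> be the volumes and the Ricci affine functions of \<open>P\<close> and
  \<open>Q\<close>. Fubini's theorem shows that the affine function
  \<open>(V\<^sub>1 l\<^sub>1(x) + V\<^sub>2 l\<^sub>2(y) - 1) / (V\<^sub>1 V\<^sub>2)\<close> represents evaluation at the origin on \<open>P \<times> Q\<close>: against
  \<open>u\<^sub>1(x) + u\<^sub>2(y)\<close>, the diagonal terms give \<open>u\<^sub>1(0) + u\<^sub>2(0)\<close>, and the mixed terms cancel against the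
  constant \<open>-1\<close> because \<open>l\<^sub>1\<close> and \<open>l\<^sub>2\<close> have integral 1 (take \<open>u = 1\<close> in their definition). The Ricci
  affine function is unique, so this is the one of \<open>P \<times> Q\<close>. Multiplying by the volume \<open>V\<^sub>1 V\<^sub>2\<close> and
  subtracting from 1 turns the formula into \<open>\<theta>(x, y) = \<theta>\<^sub>1(x) + \<theta>\<^sub>2(y)\<close> (\<open>potential_product\<close>). The
  variables \<open>x \<in> P\<close> and \<open>y \<in> Q\<close> are independent, so the maximum of this sum is the sum of the maxima
  (\<open>mabuchi_constant_product\<close>). Induction on the number of factors does the rest.

  The induction runs over the class of bounded measurable sets that contain a neighbourhood of the
  origin and on which affine functions attain their maxima (\<open>affine_body\<close>): it contains the reflexive
  polytopes and is closed under products. On such a set the form \<open>(u, v) \<mapsto> \<integral> u v\<close> is positive definite on affine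
  functions, which gives existence and uniqueness of the Ricci affine function. Existence amounts to
  solving the linear system of the Gram matrix of the functions \<open>1, x\<^sub>0, \<dots>, x\<^bsub>n-1\<^esub>\<close>
  (\<open>anisotropic_system_solvable\<close>).
\<close>

section \<open>Affine functions and Lebesgue measure on the coordinate spaces\<close>

lemma affine_functionI: "(\<And>x. u x = a + (\<Sum>i<n. b i * x i)) \<Longrightarrow> affine_function n u"
  unfolding affine_function_def by blast

lemma affine_function_const: "affine_function n (\<lambda>x. c)"
  by (rule affine_functionI[where a = c and b = "\<lambda>_. 0"]) simp

lemma affine_function_scale: "affine_function n u \<Longrightarrow> affine_function n (\<lambda>x. c * u x)"
  unfolding affine_function_def
  by (elim exE, rule_tac x="c * a" in exI, rule_tac x="\<lambda>i. c * b i" in exI)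
    (simp add: algebra_simps sum_distrib_left)

lemma affine_function_add:
  "affine_function n u \<Longrightarrow> affine_function n v \<Longrightarrow> affine_function n (\<lambda>x. u x + v x)"
  unfolding affine_function_def
  by (elim exE, rule_tac x="a + aa" in exI, rule_tac x="\<lambda>i. b i + ba i" in exI)
    (simp add: algebra_simps sum.distrib)

lemma affine_function_diff:
  "affine_function n u \<Longrightarrow> affine_function n v \<Longrightarrow> affine_function n (\<lambda>x. u x - v x)"
  using affine_function_add[of n u "\<lambda>x. - 1 * v x"] affine_function_scale[of n v "- 1"] by simp

lemma space_leb: "space (leb n) = real_space n"
  by (simp add: leb_def real_space_def space_PiM)

lemma product_sigma_finite_lborel: "product_sigma_finite (\<lambda>_::nat. lborel :: real measure)"
  by standard

lemma sigma_finite_leb: "sigma_finite_measure (leb n)"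
  unfolding leb_def by (intro product_sigma_finite.sigma_finite product_sigma_finite_lborel) simp

lemma emeasure_leb_box:
  "(\<And>i. i < n \<Longrightarrow> A i \<in> sets lborel) \<Longrightarrow>
    emeasure (leb n) (Pi\<^sub>E {..<n} A) = (\<Prod>i<n. emeasure lborel (A i))"
  unfolding leb_def by (subst product_sigma_finite.emeasure_PiM[OF product_sigma_finite_lborel]) auto

lemma sets_leb_box:
  "(\<And>i. i < n \<Longrightarrow> A i \<in> sets lborel) \<Longrightarrow> Pi\<^sub>E {..<n} A \<in> sets (leb n)"
  unfolding leb_def by (intro sets_PiM_I_finite) auto

lemma measurable_leb_component[measurable]: "i < n \<Longrightarrow> (\<lambda>x. x i) \<in> borel_measurable (leb n)"
  unfolding leb_def by measurable

lemma borel_measurable_affine: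
  assumes "affine_function n u" shows "u \<in> borel_measurable (leb n)"
proof -
  from assms obtain a b where u: "u = (\<lambda>x. a + (\<Sum>i<n. b i * x i))"
    unfolding affine_function_def by blast
  show ?thesis unfolding u
    by (intro borel_measurable_add borel_measurable_const borel_measurable_sum
        borel_measurable_times measurable_leb_component) auto
qed

lemma set_integral_sum:
  fixes f :: "'i \<Rightarrow> 'a \<Rightarrow> real"
  assumes "\<And>i. i \<in> I \<Longrightarrow> set_integrable M A (f i)"
  shows "(LINT x:A|M. (\<Sum>i\<in>I. f i x)) = (\<Sum>i\<in>I. LINT x:A|M. f i x)"
  using assms unfolding set_lebesgue_integral_def set_integrable_def
  by (simp add: sum_distrib_left)

section \<open>Bodies and their Ricci affine functions\<close>

text \<open>
  The cube forces positive volume in every open part of a neighbourhood of the origin, which makes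
  the integral of the square of an affine function definite. Attained maxima replace compactness
  and convexity: they are what the Mabuchi constant needs, and they pass to products by taking a
  maximizer in each factor.
\<close>

definition affine_body :: "nat \<Rightarrow> point set \<Rightarrow> bool" where
  "affine_body n P \<longleftrightarrow>
     P \<in> sets (leb n) \<and>
     (\<exists>B. \<forall>x\<in>P. \<forall>i<n. \<bar>x i\<bar> \<le> B) \<and>
     (\<exists>e>0. ({..<n} \<rightarrow>\<^sub>E {-e..e}) \<subseteq> P) \<and>
     (\<forall>u. affine_function n u \<longrightarrow> (\<exists>x\<in>P. \<forall>y\<in>P. u y \<le> u x))"

lemma affine_body_sets: "affine_body n P \<Longrightarrow> P \<in> sets (leb n)"
  by (simp add: affine_body_def)

lemma affine_body_subset: "affine_body n P \<Longrightarrow> P \<subseteq> real_space n"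
  using sets.sets_into_space[of P "leb n"] by (simp add: affine_body_def space_leb)

lemma emeasure_affine_body:
  assumes "affine_body n P" shows "emeasure (leb n) P < \<infinity>" "0 < measure (leb n) P"
proof -
  obtain B where B: "\<And>x i. x \<in> P \<Longrightarrow> i < n \<Longrightarrow> \<bar>x i\<bar> \<le> B" and P: "P \<in> sets (leb n)"
    using assms by (auto simp: affine_body_def)
  obtain e where e: "e > 0" "({..<n} \<rightarrow>\<^sub>E {-e..e}) \<subseteq> P"
    using assms by (auto simp: affine_body_def)
  have "P \<subseteq> {..<n} \<rightarrow>\<^sub>E {-B..B}"
  proof
    fix x assume x: "x \<in> P"
    then have "x \<in> real_space n" using affine_body_subset[OF assms] by blast
    then show "x \<in> {..<n} \<rightarrow>\<^sub>E {-B..B}"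
      using B[OF x] by (auto simp: real_space_def PiE_iff abs_le_iff minus_le_iff)
  qed
  then have "emeasure (leb n) P \<le> emeasure (leb n) ({..<n} \<rightarrow>\<^sub>E {-B..B})"
    by (intro emeasure_mono sets_leb_box) auto
  also have "\<dots> < \<infinity>"
    by (subst emeasure_leb_box) (auto simp: less_top[symmetric] power_eq_top_ennreal emeasure_lborel_Icc_eq)
  finally show fin: "emeasure (leb n) P < \<infinity>" .
  have "emeasure (leb n) ({..<n} \<rightarrow>\<^sub>E {-e..e}) \<noteq> 0"
    using e by (subst emeasure_leb_box) auto
  then have "0 < emeasure (leb n) ({..<n} \<rightarrow>\<^sub>E {-e..e})"
    by (simp only: zero_less_iff_neq_zero not_False_eq_True)
  also have "\<dots> \<le> emeasure (leb n) P"
    by (intro emeasure_mono e P)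
  finally show "0 < measure (leb n) P"
    using fin by (simp add: measure_def enn2real_positive_iff)
qed

lemma affine_bounded_on_body:
  assumes "affine_body n P" "affine_function n u"
  shows "\<exists>C. \<forall>x\<in>P. \<bar>u x\<bar> \<le> C"
proof -
  obtain B where B: "\<And>x i. x \<in> P \<Longrightarrow> i < n \<Longrightarrow> \<bar>x i\<bar> \<le> B"
    using assms by (auto simp: affine_body_def)
  obtain a b where u: "u = (\<lambda>x. a + (\<Sum>i<n. b i * x i))"
    using assms unfolding affine_function_def by blast
  have "\<bar>u x\<bar> \<le> \<bar>a\<bar> + (\<Sum>i<n. \<bar>b i\<bar> * B)" if "x \<in> P" for x
  proof -
    have "\<bar>\<Sum>i<n. b i * x i\<bar> \<le> (\<Sum>i<n. \<bar>b i * x i\<bar>)" by (rule sum_abs)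
    also have "\<dots> \<le> (\<Sum>i<n. \<bar>b i\<bar> * B)"
      using B[OF that] by (intro sum_mono) (auto simp: abs_mult intro: mult_left_mono)
    finally show ?thesis unfolding u by linarith
  qed
  then show ?thesis by blast
qed

lemma set_integrable_affine_mult:
  assumes "affine_body n P" "affine_function n u" "affine_function n v"
  shows "set_integrable (leb n) P (\<lambda>x. u x * v x)"
proof -
  obtain C where C: "\<And>x. x \<in> P \<Longrightarrow> \<bar>u x\<bar> \<le> C" using affine_bounded_on_body[OF assms(1,2)] by blast
  obtain D where D: "\<And>x. x \<in> P \<Longrightarrow> \<bar>v x\<bar> \<le> D" using affine_bounded_on_body[OF assms(1,3)] by blast
  have "\<bar>u x * v x\<bar> \<le> C * D" if "x \<in> P" for x
    using C[OF that] D[OF that] by (auto simp: abs_mult intro!: mult_mono)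
  moreover have "(\<lambda>x. u x * v x) \<in> borel_measurable (leb n)"
    by (intro borel_measurable_times borel_measurable_affine assms)
  ultimately show ?thesis
    unfolding set_integrable_def
    by (intro integrableI_bounded_set_indicator[where B="C * D"])
      (use emeasure_affine_body(1)[OF assms(1)] in \<open>auto simp: affine_body_sets[OF assms(1)]\<close>)
qed

lemma set_integrable_affine:
  "affine_body n P \<Longrightarrow> affine_function n u \<Longrightarrow> set_integrable (leb n) P u"
  using set_integrable_affine_mult[of n P u "\<lambda>_. 1"] by (simp add: affine_function_const)

text \<open>
  If the integral vanishes, then \<open>w\<close> is zero almost everywhere on the body. By continuity it cannot
  be nonzero at a point of the inner cube, since then it would be nonzero on a small box of positive
  measure. Evaluation at the origin and at the points \<open>e/2\<close> on the coordinate axes recovers the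
  coefficients.
\<close>

lemma affine_square_integral_eq_0:
  assumes body: "affine_body n P" and w: "w = (\<lambda>x. a + (\<Sum>i<n. b i * x i))"
    and zero: "(LINT x:P|leb n. w x * w x) = 0"
  shows "a = 0 \<and> (\<forall>i<n. b i = 0)"
proof -
  obtain e where e: "e > 0" "({..<n} \<rightarrow>\<^sub>E {-e..e}) \<subseteq> P"
    using body by (auto simp: affine_body_def)
  have aff: "affine_function n w" using w by (auto simp: affine_function_def)
  have AE0: "AE x in leb n. x \<in> P \<longrightarrow> w x = 0"
  proof -
    have "AE x in leb n. indicator P x *\<^sub>R (w x * w x) = 0"
      using zero set_integrable_affine_mult[OF body aff aff]
      unfolding set_lebesgue_integral_def set_integrable_def
      by (subst (asm) integral_nonneg_eq_0_iff_AE) auto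
    then show ?thesis by eventually_elim (auto simp: indicator_def)
  qed
  have vanish: "a + (\<Sum>i<n. b i * z i) = 0" if z: "\<And>i. i < n \<Longrightarrow> \<bar>z i\<bar> \<le> e / 2" for z
  proof (rule ccontr)
    assume nz: "a + (\<Sum>i<n. b i * z i) \<noteq> 0"
    \<comment> \<open>On a box of radius \<open>d\<close> around \<open>z\<close>, \<open>w\<close> varies by at most \<open>d\<close> times the \<open>\<ell>\<^sub>1\<close>-norm of \<open>b\<close>. The
      summand 1 in \<open>S\<close> keeps the quotient meaningful when \<open>b = 0\<close> and the estimate strict, and \<open>d\<close> is chosen to keep the
      variation below half of the value of \<open>w\<close> at \<open>z\<close>.\<close>
    define S where "S = 1 + (\<Sum>i<n. \<bar>b i\<bar>)"
    have S: "S > 0" unfolding S_def by (simp add: add_pos_nonneg sum_nonneg)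
    define d where "d = min (e / 2) (\<bar>a + (\<Sum>i<n. b i * z i)\<bar> / (2 * S))"
    have d: "d > 0" "d \<le> e / 2" using e nz S by (auto simp: d_def)
    define Q where "Q = Pi\<^sub>E {..<n} (\<lambda>i. {z i - d..z i + d})"
    have QP: "Q \<subseteq> P"
    proof -
      have "Q \<subseteq> ({..<n} \<rightarrow>\<^sub>E {-e..e})"
        unfolding Q_def using z d by (intro PiE_mono) (force simp: abs_le_iff)
      then show ?thesis using e by blast
    qed
    have near: "y \<noteq> 0" if "\<bar>y - c\<bar> < \<bar>c\<bar> / 2" for y c :: real
      using that by auto
    have Qw: "w x \<noteq> 0" if "x \<in> Q" for x
    proof -
      have "\<bar>w x - (a + (\<Sum>i<n. b i * z i))\<bar> = \<bar>\<Sum>i<n. b i * (x i - z i)\<bar>"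
        by (simp add: w algebra_simps sum_subtractf)
      also have "\<dots> \<le> (\<Sum>i<n. \<bar>b i * (x i - z i)\<bar>)" by (rule sum_abs)
      also have "\<dots> \<le> (\<Sum>i<n. \<bar>b i\<bar> * d)"
      proof (intro sum_mono)
        fix i assume "i \<in> {..<n}"
        then have "\<bar>x i - z i\<bar> \<le> d" using that by (force simp: Q_def PiE_iff abs_le_iff algebra_simps)
        then show "\<bar>b i * (x i - z i)\<bar> \<le> \<bar>b i\<bar> * d"
          by (auto simp: abs_mult intro: mult_left_mono)
      qed
      also have "\<dots> < S * d" using d by (simp add: S_def sum_distrib_right[symmetric])
      also have "\<dots> \<le> \<bar>a + (\<Sum>i<n. b i * z i)\<bar> / 2"
      proof -
        have "d \<le> \<bar>a + (\<Sum>i<n. b i * z i)\<bar> / (2 * S)" by (simp add: d_def)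
        then have "S * d \<le> S * (\<bar>a + (\<Sum>i<n. b i * z i)\<bar> / (2 * S))" using S by (intro mult_left_mono) auto
        then show ?thesis using S by simp
      qed
      finally show ?thesis by (rule near)
    qed
    have "Q \<in> sets (leb n)" unfolding Q_def by (intro sets_leb_box) auto
    moreover have "AE x in leb n. x \<notin> Q"
      using AE0 by eventually_elim (use QP Qw in auto)
    ultimately have "emeasure (leb n) Q = 0"
      using AE_iff_measurable[of Q "leb n" "\<lambda>x. x \<notin> Q"] sets.sets_into_space[of Q "leb n"] by auto
    moreover have "emeasure (leb n) Q \<noteq> 0"
      unfolding Q_def using d by (subst emeasure_leb_box) auto
    ultimately show False by contradiction
  qed
  have a0: "a = 0" using vanish[of "\<lambda>_. 0"] e by simp
  moreover have "b i = 0" if "i < n" for i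
  proof -
    have "(\<Sum>j<n. b j * (if j = i then e / 2 else 0)) = b i * (e / 2)"
      using that by (subst sum.remove[of _ i]) auto
    then show ?thesis using vanish[of "\<lambda>j. if j = i then e / 2 else 0"] e a0 by auto
  qed
  ultimately show ?thesis by blast
qed

text \<open>
  Solvability of a linear system without matrices of a fixed size: the induction is Gram--Schmidt.
  The \<open>n\<close>-th unit vector is corrected to a vector \<open>h\<close> whose pairing with the first \<open>n\<close> indices
  vanishes; its last pairing \<open>s\<close> is the value of the quadratic form at \<open>h\<close>, so it is nonzero. A multiple
  of \<open>h\<close> then repairs the last equation without disturbing the earlier ones.
\<close>

lemma anisotropic_system_solvable:
  fixes G :: "nat \<Rightarrow> nat \<Rightarrow> real"
  assumes "\<And>c. (\<Sum>j<n. \<Sum>i<n. c i * c j * G i j) = 0 \<Longrightarrow> \<forall>i<n. c i = 0"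
  shows "\<exists>c. \<forall>j<n. (\<Sum>i<n. c i * G i j) = f j"
  using assms
proof (induction n arbitrary: f)
  case 0
  then show ?case by simp
next
  case (Suc n)
  have IH: "\<exists>c. \<forall>j<n. (\<Sum>i<n. c i * G i j) = f j" for f
  proof (rule Suc.IH)
    fix c assume *: "(\<Sum>j<n. \<Sum>i<n. c i * c j * G i j) = 0"
    \<comment> \<open>Definiteness is inherited by the leading minor: extend \<open>c\<close> by zero.\<close>
    define c' where "c' = c(n := 0)"
    have "(\<Sum>j<Suc n. \<Sum>i<Suc n. c' i * c' j * G i j) = (\<Sum>j<n. \<Sum>i<n. c' i * c' j * G i j)"
      by (simp add: c'_def)
    also have "\<dots> = (\<Sum>j<n. \<Sum>i<n. c i * c j * G i j)"
      by (intro sum.cong refl) (auto simp: c'_def)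
    finally show "\<forall>i<n. c i = 0" using Suc.prems[of c'] * by (metis c'_def fun_upd_other less_SucI less_irrefl)
  qed
  obtain c where c: "\<And>j. j < n \<Longrightarrow> (\<Sum>i<n. c i * G i j) = f j" using IH[of f] by blast
  obtain d where d: "\<And>j. j < n \<Longrightarrow> (\<Sum>i<n. d i * G i j) = G n j" using IH[of "G n"] by blast
  define h where "h i = (if i = n then 1 else - d i)" for i
  define s where "s = (\<Sum>i<Suc n. h i * G i n)"
  have h0: "(\<Sum>i<Suc n. h i * G i j) = 0" if "j < n" for j
    using d[OF that] by (simp add: h_def sum_negf)
  have "s \<noteq> 0"
  proof
    assume "s = 0"
    then have "(\<Sum>i<Suc n. h i * G i j) = 0" if "j < Suc n" for j
      using h0 that by (cases "j = n") (auto simp: s_def less_Suc_eq)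
    then have "(\<Sum>j<Suc n. h j * (\<Sum>i<Suc n. h i * G i j)) = 0"
      by (intro sum.neutral) auto
    then have "(\<Sum>j<Suc n. \<Sum>i<Suc n. h i * h j * G i j) = 0"
      by (simp only: sum_distrib_left mult.assoc mult.left_commute)
    then show False using Suc.prems[of h] by (auto simp: h_def)
  qed
  define t where "t = (f n - (\<Sum>i<n. c i * G i n)) / s"
  have key: "(\<Sum>i<Suc n. ((if i = n then 0 else c i) + t * h i) * G i j)
      = (\<Sum>i<n. c i * G i j) + t * (\<Sum>i<Suc n. h i * G i j)" for j
  proof -
    have "(\<Sum>i<Suc n. ((if i = n then 0 else c i) + t * h i) * G i j)
      = (\<Sum>i<Suc n. (if i = n then 0 else c i) * G i j) + t * (\<Sum>i<Suc n. h i * G i j)"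
      by (simp only: distrib_right sum.distrib sum_distrib_left mult.assoc)
    also have "(\<Sum>i<Suc n. (if i = n then 0 else c i) * G i j) = (\<Sum>i<n. c i * G i j)" by simp
    finally show ?thesis .
  qed
  have "(\<Sum>i<Suc n. ((if i = n then 0 else c i) + t * h i) * G i j) = f j" if "j < Suc n" for j
  proof (cases "j = n")
    case True
    then show ?thesis unfolding key using \<open>s \<noteq> 0\<close> by (simp add: s_def[symmetric] t_def del: sum.lessThan_Suc)
  next
    case False
    then show ?thesis unfolding key using that c h0 by (simp del: sum.lessThan_Suc)
  qed
  then show ?case by (intro exI[of _ "\<lambda>i. (if i = n then 0 else c i) + t * h i"]) blast
qed

text \<open>The condition that \<open>ricci_affine\<close> describes, stated as a predicate so that it can be verified for
  explicit candidates.\<close>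

definition represents_origin :: "nat \<Rightarrow> point set \<Rightarrow> (point \<Rightarrow> real) \<Rightarrow> bool" where
  "represents_origin n P l \<longleftrightarrow> affine_function n l \<and>
     (\<forall>u. affine_function n u \<longrightarrow> (LINT x:P|leb n. l x * u x) = u (origin n))"

text \<open>Testing two candidates against their difference \<open>w\<close> gives the same value \<open>w(0)\<close>, so the integral of
  \<open>w\<^sup>2\<close> vanishes.\<close>

lemma represents_origin_unique:
  assumes body: "affine_body n P" and l: "represents_origin n P l" and l': "represents_origin n P l'"
  shows "l = l'"
proof -
  define w where "w = (\<lambda>x. l x - l' x)"
  have aff: "affine_function n l" "affine_function n l'" "affine_function n w"
    using l l' by (auto simp: represents_origin_def w_def intro: affine_function_diff)
  have "(LINT x:P|leb n. w x * w x) = (LINT x:P|leb n. l x * w x - l' x * w x)"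
    by (simp add: w_def algebra_simps)
  also have "\<dots> = (LINT x:P|leb n. l x * w x) - (LINT x:P|leb n. l' x * w x)"
    by (intro set_integral_diff set_integrable_affine_mult body aff)
  also have "\<dots> = 0" using l l' aff by (simp add: represents_origin_def)
  finally have 0: "(LINT x:P|leb n. w x * w x) = 0" .
  obtain a b where w: "w = (\<lambda>x. a + (\<Sum>i<n. b i * x i))"
    using aff by (auto simp: affine_function_def)
  then have "w = (\<lambda>x. 0)"
    using affine_square_integral_eq_0[OF body w 0] by auto
  then show ?thesis by (auto simp: w_def fun_eq_iff)
qed

text \<open>
  In the basis of coordinate functions and the constant 1, the coefficients of a representing
  function solve the linear system of the Gram matrix \<open>G\<close>, which is definite by
  \<open>affine_square_integral_eq_0\<close>.
\<close>

lemma represents_origin_exists: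
  assumes body: "affine_body n P"
  shows "\<exists>l. represents_origin n P l"
proof -
  \<comment> \<open>The constant function takes the last index \<open>n\<close>, so that the coordinates keep their indices.\<close>
  define \<phi> where "\<phi> i = (\<lambda>x::point. if i = n then 1 else x i)" for i
  have aff: "affine_function n (\<phi> i)" if "i < Suc n" for i
  proof (cases "i = n")
    case True then show ?thesis by (simp add: \<phi>_def affine_function_const)
  next
    case False
    then have "i < n" using that by simp
    then show ?thesis
      by (intro affine_functionI[where a = 0 and b = "\<lambda>j. if j = i then 1 else 0"])
        (auto simp: \<phi>_def if_distrib[of "\<lambda>c. c * _"] cong: if_cong)
  qed
  define G where "G i j = (LINT x:P|leb n. \<phi> i x * \<phi> j x)" for i j
  have expand: "(LINT x:P|leb n. (\<Sum>i<Suc n. c i * \<phi> i x) * \<phi> j x) = (\<Sum>i<Suc n. c i * G i j)"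
    if "j < Suc n" for c j
  proof -
    have "(LINT x:P|leb n. (\<Sum>i<Suc n. c i * \<phi> i x) * \<phi> j x)
      = (LINT x:P|leb n. (\<Sum>i<Suc n. c i * (\<phi> i x * \<phi> j x)))"
      by (simp only: sum_distrib_right mult.assoc)
    also have "\<dots> = (\<Sum>i<Suc n. LINT x:P|leb n. c i * (\<phi> i x * \<phi> j x))"
      using that by (intro set_integral_sum set_integrable_mult_right set_integrable_affine_mult body aff) auto
    finally show ?thesis by (simp only: set_integral_mult_right G_def)
  qed
  have affc: "affine_function n (\<lambda>x. \<Sum>i<Suc n. c i * \<phi> i x)" for c
    by (intro affine_functionI[where a = "c n" and b = c]) (simp add: \<phi>_def)
  have expand2: "(LINT x:P|leb n. L x * (\<Sum>j<Suc n. c j * \<phi> j x))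
    = (\<Sum>j<Suc n. c j * (LINT x:P|leb n. L x * \<phi> j x))" if "affine_function n L" for L c
  proof -
    have "(LINT x:P|leb n. L x * (\<Sum>j<Suc n. c j * \<phi> j x))
      = (LINT x:P|leb n. (\<Sum>j<Suc n. c j * (L x * \<phi> j x)))"
      by (simp only: sum_distrib_left mult.left_commute)
    also have "\<dots> = (\<Sum>j<Suc n. LINT x:P|leb n. c j * (L x * \<phi> j x))"
      using that by (intro set_integral_sum set_integrable_mult_right set_integrable_affine_mult body aff) auto
    finally show ?thesis by (simp only: set_integral_mult_right)
  qed
  have "\<exists>c. \<forall>j<Suc n. (\<Sum>i<Suc n. c i * G i j) = \<phi> j (origin n)"
  proof (rule anisotropic_system_solvable)
    fix c assume *: "(\<Sum>j<Suc n. \<Sum>i<Suc n. c i * c j * G i j) = 0"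
    let ?w = "\<lambda>x. \<Sum>i<Suc n. c i * \<phi> i x"
    have "(LINT x:P|leb n. ?w x * ?w x) = (\<Sum>j<Suc n. c j * (\<Sum>i<Suc n. c i * G i j))"
      unfolding expand2[OF affc] by (intro sum.cong refl arg_cong2[where f="(*)"] expand) auto
    also have "\<dots> = (\<Sum>j<Suc n. \<Sum>i<Suc n. c i * c j * G i j)"
      by (simp only: sum_distrib_left mult.assoc mult.left_commute)
    finally have 0: "(LINT x:P|leb n. ?w x * ?w x) = 0" using * by simp
    have "?w = (\<lambda>x. c n + (\<Sum>i<n. c i * x i))" by (auto simp: \<phi>_def)
    from affine_square_integral_eq_0[OF body this 0] show "\<forall>i<Suc n. c i = 0"
      by (auto simp: less_Suc_eq)
  qed
  then obtain c where c: "\<And>j. j < Suc n \<Longrightarrow> (\<Sum>i<Suc n. c i * G i j) = \<phi> j (origin n)" by blast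
  let ?l = "\<lambda>x. \<Sum>i<Suc n. c i * \<phi> i x"
  have "(LINT x:P|leb n. ?l x * u x) = u (origin n)" if "affine_function n u" for u
  proof -
    obtain a b where u: "u = (\<lambda>x. a + (\<Sum>i<n. b i * x i))"
      using \<open>affine_function n u\<close> by (auto simp: affine_function_def)
    have u': "u = (\<lambda>x. \<Sum>j<Suc n. (if j = n then a else b j) * \<phi> j x)"
      unfolding u by (auto simp: \<phi>_def)
    have "(LINT x:P|leb n. ?l x * u x) = (\<Sum>j<Suc n. (if j = n then a else b j) * \<phi> j (origin n))"
      unfolding u' expand2[OF affc] by (intro sum.cong refl arg_cong2[where f="(*)"]) (use expand c in auto)
    then show ?thesis unfolding u' .
  qed
  then show ?thesis using affc by (auto simp: represents_origin_def)
qed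

lemma ricci_affine_eq: "affine_body n P \<Longrightarrow> represents_origin n P l \<Longrightarrow> ricci_affine n P = l"
  unfolding ricci_affine_def represents_origin_def[symmetric]
  by (rule the_equality) (auto intro: represents_origin_unique)

lemma represents_origin_ricci_affine:
  "affine_body n P \<Longrightarrow> represents_origin n P (ricci_affine n P)"
  using represents_origin_exists ricci_affine_eq by metis

lemma affine_function_ricci_affine: "affine_body n P \<Longrightarrow> affine_function n (ricci_affine n P)"
  using represents_origin_ricci_affine by (auto simp: represents_origin_def)

lemma affine_function_potential: "affine_body n P \<Longrightarrow> affine_function n (potential n P)"
  unfolding potential_def[abs_def]
  by (rule affine_function_diff[OF affine_function_const affine_function_scale[OF affine_function_ricci_affine]])

lemma mabuchi_constant_eqI:
  "x \<in> P \<Longrightarrow> (\<And>y. y \<in> P \<Longrightarrow> potential n P y \<le> potential n P x) \<Longrightarrow>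
    mabuchi_constant n P = potential n P x"
  unfolding mabuchi_constant_def by (rule Greatest_equality) auto

lemma mabuchi_constant_attained:
  assumes "affine_body n P"
  obtains x where "x \<in> P" "\<And>y. y \<in> P \<Longrightarrow> potential n P y \<le> potential n P x"
    "mabuchi_constant n P = potential n P x"
proof -
  have "\<exists>x\<in>P. \<forall>y\<in>P. potential n P y \<le> potential n P x"
    using assms affine_function_potential[OF assms] by (simp add: affine_body_def)
  then obtain x where "x \<in> P" "\<And>y. y \<in> P \<Longrightarrow> potential n P y \<le> potential n P x"
    by auto
  then show ?thesis using that[of x] mabuchi_constant_eqI[of x P n] by simp
qed

section \<open>Products of two bodies\<close>

definition prefix :: "nat \<Rightarrow> point \<Rightarrow> point" where
  "prefix N x = (\<lambda>i\<in>{..<N}. x i)"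

definition suffix :: "nat \<Rightarrow> nat \<Rightarrow> point \<Rightarrow> point" where
  "suffix N m x = (\<lambda>i\<in>{..<m}. x (N + i))"

definition join :: "nat \<Rightarrow> nat \<Rightarrow> point \<times> point \<Rightarrow> point" where
  "join N m p = (\<lambda>i\<in>{..<N + m}. if i < N then fst p i else snd p (i - N))"

definition product_body :: "nat \<Rightarrow> nat \<Rightarrow> point set \<Rightarrow> point set \<Rightarrow> point set" where
  "product_body N m P Q = {x \<in> real_space (N + m). prefix N x \<in> P \<and> suffix N m x \<in> Q}"

lemma sum_lessThan_add:
  fixes f :: "nat \<Rightarrow> 'a::comm_monoid_add"
  shows "(\<Sum>i<N + m. f i) = (\<Sum>i<N. f i) + (\<Sum>i<m. f (N + i))"
  by (induction m) (auto simp: add.assoc)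

lemma prod_lessThan_add:
  fixes f :: "nat \<Rightarrow> 'a::comm_monoid_mult"
  shows "(\<Prod>i<N + m. f i) = (\<Prod>i<N. f i) * (\<Prod>i<m. f (N + i))"
  by (induction m) (auto simp: mult.assoc)

lemma join_in_real_space: "join N m p \<in> real_space (N + m)"
  by (auto simp: join_def real_space_def)

lemma prefix_join: "x \<in> real_space N \<Longrightarrow> prefix N (join N m (x, y)) = x"
  by (auto simp: prefix_def join_def real_space_def PiE_iff extensional_def restrict_def fun_eq_iff)

lemma suffix_join: "y \<in> real_space m \<Longrightarrow> suffix N m (join N m (x, y)) = y"
  by (auto simp: suffix_def join_def real_space_def PiE_iff extensional_def restrict_def fun_eq_iff)

lemma join_in_product_body_iff:
  "x \<in> real_space N \<Longrightarrow> y \<in> real_space m \<Longrightarrow>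
    join N m (x, y) \<in> product_body N m P Q \<longleftrightarrow> x \<in> P \<and> y \<in> Q"
  by (simp add: product_body_def prefix_join suffix_join join_in_real_space)

text \<open>An affine function on the product has no mixed terms, which is what allows Fubini to reduce every
  integral to integrals over the factors. The constant term goes to the first summand.\<close>

lemma affine_function_split:
  assumes "affine_function (N + m) u"
  shows "\<exists>u1 u2. affine_function N u1 \<and> affine_function m u2 \<and>
    (\<forall>x. u x = u1 (prefix N x) + u2 (suffix N m x))"
proof -
  from assms obtain a b where u: "u = (\<lambda>x. a + (\<Sum>i<N + m. b i * x i))"
    unfolding affine_function_def by blast
  show ?thesis
  proof (intro exI conjI)
    show "affine_function N (\<lambda>x. a + (\<Sum>i<N. b i * x i))" by (rule affine_functionI) (rule refl)
    show "affine_function m (\<lambda>x. 0 + (\<Sum>i<m. b (N + i) * x i))" by (rule affine_functionI) (rule refl)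
  qed (simp add: u sum_lessThan_add prefix_def suffix_def)
qed

lemma affine_function_combine:
  assumes "affine_function N u1" "affine_function m u2"
  shows "affine_function (N + m) (\<lambda>x. u1 (prefix N x) + u2 (suffix N m x))"
proof -
  obtain a1 b1 where 1: "u1 = (\<lambda>x. a1 + (\<Sum>i<N. b1 i * x i))"
    using assms(1) unfolding affine_function_def by blast
  obtain a2 b2 where 2: "u2 = (\<lambda>x. a2 + (\<Sum>i<m. b2 i * x i))"
    using assms(2) unfolding affine_function_def by blast
  show ?thesis
    by (rule affine_functionI[where a = "a1 + a2" and b = "\<lambda>i. if i < N then b1 i else b2 (i - N)"])
      (simp add: 1 2 sum_lessThan_add prefix_def suffix_def)
qed

lemma measurable_prefix: "prefix N \<in> measurable (leb (N + m)) (leb N)"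
  unfolding leb_def prefix_def[abs_def] by (intro measurable_restrict measurable_component_singleton) auto

lemma measurable_suffix: "suffix N m \<in> measurable (leb (N + m)) (leb m)"
  unfolding leb_def suffix_def[abs_def] by (intro measurable_restrict measurable_component_singleton) auto

lemma measurable_join: "join N m \<in> measurable (leb N \<Otimes>\<^sub>M leb m) (leb (N + m))"
proof -
  have "(\<lambda>p. if i < N then fst p i else snd p (i - N)) \<in> measurable (leb N \<Otimes>\<^sub>M leb m) lborel"
    if "i \<in> {..<N + m}" for i
  proof (cases "i < N")
    case True
    then show ?thesis
      using measurable_compose[OF measurable_fst measurable_leb_component[of i N]] by simp
  next
    case False
    then have "i - N < m" using that by auto
    then show ?thesis
      using False measurable_compose[OF measurable_snd measurable_leb_component[of "i - N" m]] by simp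
  qed
  then show ?thesis
    unfolding join_def[abs_def] leb_def[of "N + m"] by (rule measurable_restrict)
qed

text \<open>Concatenation carries product measure to Lebesgue measure: it is enough to compare boxes, and the
  preimage of a box is a product of boxes.\<close>

lemma distr_join: "distr (leb N \<Otimes>\<^sub>M leb m) (leb (N + m)) (join N m) = leb (N + m)"
proof -
  interpret L: sigma_finite_measure "leb m" by (rule sigma_finite_leb)
  let ?D = "distr (leb N \<Otimes>\<^sub>M leb m) (leb (N + m)) (join N m)"
  have "emeasure ?D (Pi\<^sub>E {..<N + m} A) = (\<Prod>i<N + m. emeasure lborel (A i))"
    if A: "\<And>i. i \<in> {..<N + m} \<Longrightarrow> A i \<in> sets lborel" for A
  proof -
    have box: "Pi\<^sub>E {..<N + m} A \<in> sets (leb (N + m))"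
      "Pi\<^sub>E {..<N} A \<in> sets (leb N)" "Pi\<^sub>E {..<m} (\<lambda>i. A (N + i)) \<in> sets (leb m)"
      using A by (auto intro!: sets_leb_box)
    have *: "join N m (x, y) \<in> Pi\<^sub>E {..<N + m} A \<longleftrightarrow>
        x \<in> Pi\<^sub>E {..<N} A \<and> y \<in> Pi\<^sub>E {..<m} (\<lambda>i. A (N + i))"
      if "x \<in> real_space N" "y \<in> real_space m" for x y
    proof -
      have "join N m (x, y) \<in> Pi\<^sub>E {..<N + m} A \<longleftrightarrow>
          (\<forall>i<N + m. (if i < N then x i else y (i - N)) \<in> A i)"
        by (auto simp: join_def PiE_iff)
      also have "\<dots> \<longleftrightarrow> (\<forall>i<N. x i \<in> A i) \<and> (\<forall>i<m. y i \<in> A (N + i))"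
      proof safe
        fix i assume "\<forall>i<N + m. (if i < N then x i else y (i - N)) \<in> A i" "i < N"
        then show "x i \<in> A i" by (auto dest!: spec[of _ i])
      next
        fix i assume "\<forall>i<N + m. (if i < N then x i else y (i - N)) \<in> A i" "i < m"
        then show "y i \<in> A (N + i)" by (auto dest!: spec[of _ "N + i"])
      next
        fix i assume "\<forall>i<N. x i \<in> A i" "\<forall>i<m. y i \<in> A (N + i)" "i < N + m"
        then show "(if i < N then x i else y (i - N)) \<in> A i" by (auto dest!: spec[of _ "i - N"])
      qed
      finally show ?thesis using that by (auto simp: real_space_def PiE_iff)
    qed
    have "join N m -` Pi\<^sub>E {..<N + m} A \<inter> space (leb N \<Otimes>\<^sub>M leb m)
        = Pi\<^sub>E {..<N} A \<times> Pi\<^sub>E {..<m} (\<lambda>i. A (N + i))"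
    proof -
      have "Pi\<^sub>E {..<N} A \<subseteq> real_space N" "Pi\<^sub>E {..<m} (\<lambda>i. A (N + i)) \<subseteq> real_space m"
        by (auto simp: real_space_def PiE_iff)
      then have "(x, y) \<in> join N m -` Pi\<^sub>E {..<N + m} A \<inter> space (leb N \<Otimes>\<^sub>M leb m) \<longleftrightarrow>
          (x, y) \<in> Pi\<^sub>E {..<N} A \<times> Pi\<^sub>E {..<m} (\<lambda>i. A (N + i))" for x y
        using *[of x y] unfolding vimage_eq Int_iff space_pair_measure space_leb mem_Sigma_iff
        by (meson subsetD)
      then show ?thesis by (intro set_eqI) (metis surj_pair)
    qed
    then have "emeasure ?D (Pi\<^sub>E {..<N + m} A)
        = emeasure (leb N) (Pi\<^sub>E {..<N} A) * emeasure (leb m) (Pi\<^sub>E {..<m} (\<lambda>i. A (N + i)))"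
      using box by (simp add: emeasure_distr measurable_join L.emeasure_pair_measure_Times)
    also have "\<dots> = (\<Prod>i<N + m. emeasure lborel (A i))"
      using A by (simp add: emeasure_leb_box prod_lessThan_add)
    finally show ?thesis .
  qed
  then have "?D = (\<Pi>\<^sub>M i\<in>{..<N + m}. lborel)"
    by (intro product_sigma_finite.PiM_eqI[OF product_sigma_finite_lborel]) (auto simp: leb_def)
  then show ?thesis by (simp add: leb_def[symmetric])
qed

text \<open>Fubini's theorem, transported along concatenation of coordinates.\<close>

lemma set_integral_product_body:
  fixes f :: "point \<Rightarrow> real"
  assumes int: "set_integrable (leb (N + m)) (product_body N m P Q) f"
  shows "(LINT z:product_body N m P Q|leb (N + m). f z) =
    (LINT x:P|leb N. LINT y:Q|leb m. f (join N m (x, y)))"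
proof -
  interpret pair_sigma_finite "leb N" "leb m"
    by (intro pair_sigma_finite.intro sigma_finite_leb)
  let ?F = "\<lambda>z. indicator (product_body N m P Q) z *\<^sub>R f z"
  have F: "integrable (leb (N + m)) ?F" using int by (simp add: set_integrable_def)
  then have "?F \<in> borel_measurable (leb (N + m))" by (rule borel_measurable_integrable)
  then have "(\<integral>z. ?F z \<partial>leb (N + m)) = (\<integral>p. ?F (join N m p) \<partial>(leb N \<Otimes>\<^sub>M leb m))"
    by (subst distr_join[symmetric], subst integral_distr[OF measurable_join]) auto
  also have "\<dots> = (\<integral>x. \<integral>y. ?F (join N m (x, y)) \<partial>leb m \<partial>leb N)"
  proof (rule integral_fst'[symmetric])
    show "integrable (leb N \<Otimes>\<^sub>M leb m) (\<lambda>p. ?F (join N m p))"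
      using F by (subst (asm) distr_join[symmetric], subst (asm) integrable_distr_eq[OF measurable_join])
        (auto intro: borel_measurable_integrable[OF F])
  qed
  also have "\<dots> = (\<integral>x. indicator P x *\<^sub>R (\<integral>y. indicator Q y *\<^sub>R f (join N m (x, y)) \<partial>leb m) \<partial>leb N)"
  proof (rule Bochner_Integration.integral_cong[OF refl])
    fix x assume x: "x \<in> space (leb N)"
    have "(\<integral>y. ?F (join N m (x, y)) \<partial>leb m)
        = (\<integral>y. indicator P x *\<^sub>R (indicator Q y *\<^sub>R f (join N m (x, y))) \<partial>leb m)"
      using x by (intro Bochner_Integration.integral_cong[OF refl])
        (auto simp: indicator_def join_in_product_body_iff space_leb)
    then show "(\<integral>y. ?F (join N m (x, y)) \<partial>leb m)
        = indicator P x *\<^sub>R (\<integral>y. indicator Q y *\<^sub>R f (join N m (x, y)) \<partial>leb m)"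
      by simp
  qed
  finally show ?thesis by (simp add: set_lebesgue_integral_def)
qed

lemma affine_body_product:
  assumes P: "affine_body N P" and Q: "affine_body m Q"
  shows "affine_body (N + m) (product_body N m P Q)"
  unfolding affine_body_def
proof (intro conjI allI impI)
  have [measurable]: "prefix N \<in> measurable (leb (N + m)) (leb N)"
    "suffix N m \<in> measurable (leb (N + m)) (leb m)" "P \<in> sets (leb N)" "Q \<in> sets (leb m)"
    by (auto intro: measurable_prefix measurable_suffix affine_body_sets P Q)
  have "{x \<in> space (leb (N + m)). prefix N x \<in> P \<and> suffix N m x \<in> Q} \<in> sets (leb (N + m))"
    by measurable
  then show "product_body N m P Q \<in> sets (leb (N + m))"
    by (simp add: product_body_def space_leb)
next
  obtain B where B: "\<And>x i. x \<in> P \<Longrightarrow> i < N \<Longrightarrow> \<bar>x i\<bar> \<le> B" using P by (auto simp: affine_body_def)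
  obtain C where C: "\<And>x i. x \<in> Q \<Longrightarrow> i < m \<Longrightarrow> \<bar>x i\<bar> \<le> C" using Q by (auto simp: affine_body_def)
  have "\<bar>x i\<bar> \<le> max B C" if x: "x \<in> product_body N m P Q" and i: "i < N + m" for x i
  proof (cases "i < N")
    case True
    then show ?thesis using B[of "prefix N x" i] x by (auto simp: product_body_def prefix_def)
  next
    case False
    then show ?thesis using C[of "suffix N m x" "i - N"] x i by (auto simp: product_body_def suffix_def le_max_iff_disj)
  qed
  then show "\<exists>B. \<forall>x\<in>product_body N m P Q. \<forall>i<N + m. \<bar>x i\<bar> \<le> B" by blast
next
  obtain e where e: "e > 0" "({..<N} \<rightarrow>\<^sub>E {-e..e}) \<subseteq> P" using P by (auto simp: affine_body_def)
  obtain d where d: "d > 0" "({..<m} \<rightarrow>\<^sub>E {-d..d}) \<subseteq> Q" using Q by (auto simp: affine_body_def)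
  have "x \<in> product_body N m P Q" if x: "x \<in> {..<N + m} \<rightarrow>\<^sub>E {-min e d..min e d}" for x
  proof -
    have "prefix N x \<in> {..<N} \<rightarrow>\<^sub>E {-e..e}" "suffix N m x \<in> {..<m} \<rightarrow>\<^sub>E {-d..d}"
      using x by (auto simp: prefix_def suffix_def PiE_iff minus_min_eq_max)
    then have "prefix N x \<in> P" "suffix N m x \<in> Q" using e(2) d(2) by blast+
    then show ?thesis using x by (simp add: product_body_def real_space_def PiE_iff)
  qed
  then show "\<exists>e>0. ({..<N + m} \<rightarrow>\<^sub>E {-e..e}) \<subseteq> product_body N m P Q"
    using e d by (intro exI[of _ "min e d"]) auto
next
  fix u assume "affine_function (N + m) u"
  then obtain u1 u2 where u12: "affine_function N u1" "affine_function m u2"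
    and u: "\<And>x. u x = u1 (prefix N x) + u2 (suffix N m x)"
    using affine_function_split by blast
  obtain x where x: "x \<in> P" "\<And>z. z \<in> P \<Longrightarrow> u1 z \<le> u1 x"
    using P u12 unfolding affine_body_def by metis
  obtain y where y: "y \<in> Q" "\<And>z. z \<in> Q \<Longrightarrow> u2 z \<le> u2 y"
    using Q u12 unfolding affine_body_def by metis
  have rs: "x \<in> real_space N" "y \<in> real_space m"
    using x y affine_body_subset P Q by blast+
  show "\<exists>x\<in>product_body N m P Q. \<forall>y\<in>product_body N m P Q. u y \<le> u x"
  proof (intro bexI ballI)
    show "join N m (x, y) \<in> product_body N m P Q"
      using rs x y by (simp add: join_in_product_body_iff)
    fix z assume "z \<in> product_body N m P Q"
    then show "u z \<le> u (join N m (x, y))"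
      unfolding u using x(2) y(2) rs
      by (intro add_mono) (auto simp: product_body_def prefix_join suffix_join)
  qed
qed

lemma set_integral_one:
  "affine_body n P \<Longrightarrow> (LINT x:P|leb n. 1) = measure (leb n) P"
  using sets.sets_into_space[of P "leb n"]
  by (auto simp: set_lebesgue_integral_def affine_body_sets Int_absorb2)

text \<open>
  The integrals over either factor in the verification of the product formula have this form. The
  coefficient \<open>b\<close> survives unchanged because \<open>l\<close> has integral 1, its pairing with the constant 1.
\<close>

lemma represents_origin_integral_combination:
  assumes body: "affine_body n P" and l: "represents_origin n P l" and u: "affine_function n u"
  shows "(LINT x:P|leb n. a * (l x * u x) + b * l x + c * u x + d) =
    a * u (origin n) + b + c * (LINT x:P|leb n. u x) + d * measure (leb n) P"
proof -
  have affl: "affine_function n l" using l by (simp add: represents_origin_def)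
  have I: "set_integrable (leb n) P (\<lambda>x. a * (l x * u x))" "set_integrable (leb n) P (\<lambda>x. b * l x)"
    "set_integrable (leb n) P (\<lambda>x. c * u x)" "set_integrable (leb n) P (\<lambda>x. d * 1)"
    by (intro set_integrable_mult_right set_integrable_affine_mult set_integrable_affine body u affl
        affine_function_const)+
  have "(LINT x:P|leb n. l x * 1) = 1"
    using l affine_function_const[of n 1] unfolding represents_origin_def by blast
  then have l1: "(LINT x:P|leb n. l x) = 1" by simp
  have "(LINT x:P|leb n. a * (l x * u x) + b * l x + c * u x + d * 1) =
    (LINT x:P|leb n. a * (l x * u x)) + (LINT x:P|leb n. b * l x) + (LINT x:P|leb n. c * u x)
      + (LINT x:P|leb n. d * 1)"
    by (simp only: set_integral_add I)
  also have "\<dots> = a * u (origin n) + b + c * (LINT x:P|leb n. u x) + d * measure (leb n) P"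
    using l u by (simp only: set_integral_mult_right set_integral_one[OF body] l1 represents_origin_def)
  finally show ?thesis by simp
qed

lemma measure_product_body:
  assumes P: "affine_body N P" and Q: "affine_body m Q"
  shows "measure (leb (N + m)) (product_body N m P Q) = measure (leb N) P * measure (leb m) Q"
proof -
  note PQ = affine_body_product[OF P Q]
  have "measure (leb (N + m)) (product_body N m P Q) = (LINT x:P|leb N. LINT y:Q|leb m. 1)"
    unfolding set_integral_one[OF PQ, symmetric]
    by (rule set_integral_product_body) (rule set_integrable_affine[OF PQ affine_function_const])
  also have "\<dots> = (LINT x:P|leb N. measure (leb m) Q * 1)" by (simp add: set_integral_one[OF Q])
  also have "\<dots> = measure (leb m) Q * measure (leb N) P"
    by (simp only: set_integral_mult_right set_integral_one[OF P])
  finally show ?thesis by (simp add: mult.commute)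
qed

text \<open>
  The formula is forced by the additivity of potentials: it is the solution of
  \<open>1 - V1 V2 l = (1 - V1 l1) + (1 - V2 l2)\<close>. It is verified by integrating over the second factor for
  fixed \<open>x\<close> and then over the first. The integral \<open>J\<close> of \<open>u2\<close> arises twice with opposite signs and
  cancels, and so does the term in \<open>u1\<close> within the inner integral.
\<close>

lemma represents_origin_product:
  assumes P: "affine_body N P" and Q: "affine_body m Q"
    and l1: "represents_origin N P l1" and l2: "represents_origin m Q l2"
  defines "V1 \<equiv> measure (leb N) P" and "V2 \<equiv> measure (leb m) Q"
  shows "represents_origin (N + m) (product_body N m P Q)
    (\<lambda>z. (V1 * l1 (prefix N z) - 1 + V2 * l2 (suffix N m z)) / (V1 * V2))"
    (is "represents_origin _ ?PQ ?l")
proof -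
  note PQ = affine_body_product[OF P Q]
  have V: "V1 > 0" "V2 > 0" using emeasure_affine_body P Q by (auto simp: V1_def V2_def)
  have aff: "affine_function N l1" "affine_function m l2"
    using l1 l2 by (simp_all add: represents_origin_def)
  have L: "affine_function (N + m) (\<lambda>z. V1 * l1 (prefix N z) - 1 + V2 * l2 (suffix N m z))"
    using affine_function_combine[OF
        affine_function_diff[OF affine_function_scale[OF aff(1)] affine_function_const]
        affine_function_scale[OF aff(2)], of V1 1 V2] .
  then have affl: "affine_function (N + m) ?l"
    using affine_function_scale[OF L, of "1 / (V1 * V2)"] by simp
  moreover have "(LINT z:?PQ|leb (N + m). ?l z * u z) = u (origin (N + m))"
    if affu: "affine_function (N + m) u" for u
  proof -
    obtain u1 u2 where u12: "affine_function N u1" "affine_function m u2"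
      and u: "\<And>x. u x = u1 (prefix N x) + u2 (suffix N m x)"
      using affine_function_split[OF affu] by blast
    define J where "J = (LINT y:Q|leb m. u2 y)"
    have inner: "(LINT y:Q|leb m. (V1 * l1 x - 1 + V2 * l2 y) * (u1 x + u2 y))
        = V1 * V2 * (l1 x * u1 x) + V1 * J * l1 x + 0 * u1 x + (V2 * u2 (origin m) - J)" for x
    proof -
      have "(LINT y:Q|leb m. (V1 * l1 x - 1 + V2 * l2 y) * (u1 x + u2 y))
        = (LINT y:Q|leb m. V2 * (l2 y * u2 y) + (V2 * u1 x) * l2 y + (V1 * l1 x - 1) * u2 y
             + (V1 * l1 x - 1) * u1 x)"
        by (simp add: algebra_simps)
      also have "\<dots> = V2 * u2 (origin m) + V2 * u1 x + (V1 * l1 x - 1) * J + (V1 * l1 x - 1) * u1 x * V2"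
        unfolding J_def V2_def by (rule represents_origin_integral_combination[OF Q l2 u12(2)])
      finally show ?thesis by (simp add: algebra_simps)
    qed
    have "(LINT z:?PQ|leb (N + m). (V1 * l1 (prefix N z) - 1 + V2 * l2 (suffix N m z)) * u z)
      = (LINT x:P|leb N. LINT y:Q|leb m.
          (V1 * l1 (prefix N (join N m (x, y))) - 1 + V2 * l2 (suffix N m (join N m (x, y))))
            * u (join N m (x, y)))"
      by (rule set_integral_product_body) (rule set_integrable_affine_mult[OF PQ L affu])
    also have "\<dots> = (LINT x:P|leb N. LINT y:Q|leb m. (V1 * l1 x - 1 + V2 * l2 y) * (u1 x + u2 y))"
    proof (intro set_lebesgue_integral_cong affine_body_sets P Q allI impI)
      fix x y assume "x \<in> P" "y \<in> Q"
      then have "x \<in> real_space N" "y \<in> real_space m" using affine_body_subset P Q by blast+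
      then show "(V1 * l1 (prefix N (join N m (x, y))) - 1 + V2 * l2 (suffix N m (join N m (x, y))))
            * u (join N m (x, y)) = (V1 * l1 x - 1 + V2 * l2 y) * (u1 x + u2 y)"
        by (simp add: u prefix_join suffix_join)
    qed
    also have "\<dots> = V1 * V2 * u1 (origin N) + V1 * J + 0 * (LINT x:P|leb N. u1 x)
        + (V2 * u2 (origin m) - J) * V1"
      unfolding inner by (rule represents_origin_integral_combination[OF P l1 u12(1), folded V1_def])
    also have "\<dots> = V1 * V2 * u (origin (N + m))"
    proof -
      have "prefix N (origin (N + m)) = origin N" "suffix N m (origin (N + m)) = origin m"
        by (auto simp: prefix_def suffix_def origin_def)
      then show ?thesis by (simp add: u algebra_simps)
    qed
    finally show ?thesis using V by simp
  qed
  ultimately show ?thesis by (simp add: represents_origin_def)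
qed

lemma potential_product:
  assumes P: "affine_body N P" and Q: "affine_body m Q"
  shows "potential (N + m) (product_body N m P Q) z =
    potential N P (prefix N z) + potential m Q (suffix N m z)"
proof -
  have "measure (leb N) P > 0" "measure (leb m) Q > 0" using emeasure_affine_body P Q by auto
  then show ?thesis
    using ricci_affine_eq[OF affine_body_product[OF P Q] represents_origin_product[OF P Q
        represents_origin_ricci_affine[OF P] represents_origin_ricci_affine[OF Q]]]
    by (simp add: potential_def measure_product_body[OF P Q])
qed

text \<open>Since the potential of the product is a sum of functions of independent variables, joining a
  maximizer on each factor gives a maximizer on the product.\<close>

lemma mabuchi_constant_product:
  assumes P: "affine_body N P" and Q: "affine_body m Q"
  shows "mabuchi_constant (N + m) (product_body N m P Q) = mabuchi_constant N P + mabuchi_constant m Q"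
proof -
  obtain x where x: "x \<in> P" "\<And>z. z \<in> P \<Longrightarrow> potential N P z \<le> potential N P x"
    "mabuchi_constant N P = potential N P x"
    using mabuchi_constant_attained[OF P] by auto
  obtain y where y: "y \<in> Q" "\<And>z. z \<in> Q \<Longrightarrow> potential m Q z \<le> potential m Q y"
    "mabuchi_constant m Q = potential m Q y"
    using mabuchi_constant_attained[OF Q] by auto
  have rs: "x \<in> real_space N" "y \<in> real_space m"
    using x y affine_body_subset P Q by blast+
  have "mabuchi_constant (N + m) (product_body N m P Q)
      = potential (N + m) (product_body N m P Q) (join N m (x, y))"
  proof (rule mabuchi_constant_eqI)
    show "join N m (x, y) \<in> product_body N m P Q"
      using rs x y by (simp add: join_in_product_body_iff)
    fix z assume "z \<in> product_body N m P Q"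
    then show "potential (N + m) (product_body N m P Q) z
        \<le> potential (N + m) (product_body N m P Q) (join N m (x, y))"
      unfolding potential_product[OF P Q] using x(2) y(2) rs
      by (intro add_mono) (auto simp: product_body_def prefix_join suffix_join)
  qed
  then show ?thesis using x y rs by (simp add: potential_product[OF P Q] prefix_join suffix_join)
qed

section \<open>Reflexive polytopes are bodies\<close>

text \<open>
  The hull is the continuous image of the simplex of weights. Compactness yields measurability:
  the hull is closed in the topology of pointwise convergence, hence Borel.
\<close>

lemma compact_conv_hull:
  assumes V: "finite V"
  shows "compact (conv_hull n V)"
proof -
  \<comment> \<open>Weights are normalized to 0 off \<open>V\<close>; without this the set of admissible weight functions on the
    whole type would not be compact.\<close>
  let ?S = "{c::point \<Rightarrow> real. (\<forall>v. c v \<in> (if v \<in> V then {0..1} else {0})) \<and> (\<Sum>v\<in>V. c v) = 1}"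
  let ?g = "\<lambda>c::point \<Rightarrow> real. (\<lambda>i\<in>{..<n}. \<Sum>v\<in>V. c v * v i)"
  have "compactin (product_topology (\<lambda>_. euclideanreal) UNIV)
      (\<Pi>\<^sub>E v\<in>(UNIV :: point set). if v \<in> V then {0..1} else {0})"
    by (subst compactin_PiE) auto
  then have box: "compact (\<Pi>\<^sub>E v\<in>(UNIV :: point set). if v \<in> V then {0..1} else {0 :: real})"
    by (simp add: euclidean_product_topology)
  have coord: "continuous_on T (\<lambda>c::point \<Rightarrow> real. c v)" for v T
    by (rule continuous_on_subset[OF continuous_on_product_coordinates]) simp
  have "closed {c::point \<Rightarrow> real. (\<Sum>v\<in>V. c v) = 1}"
    by (intro closed_Collect_eq continuous_on_sum continuous_on_const coord)
  from compact_Int_closed[OF box this] have "compact ?S"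
    by (rule back_subst[of compact]) (intro set_eqI, simp add: PiE_UNIV_domain Pi_iff)
  moreover have "continuous_on ?S ?g"
  proof (intro continuous_on_coordinatewise_then_product)
    fix i
    show "continuous_on ?S (\<lambda>c. ?g c i)"
      by (cases "i < n") (auto intro!: continuous_on_sum continuous_on_mult continuous_on_const coord)
  qed
  ultimately have "compact (?g ` ?S)" by (rule compact_continuous_image[rotated])
  also have "?g ` ?S = conv_hull n V"
  proof (intro equalityI subsetI)
    fix x assume "x \<in> ?g ` ?S"
    then obtain c where x: "x = ?g c" and c: "\<And>v. c v \<in> (if v \<in> V then {0..1} else {0})"
      "(\<Sum>v\<in>V. c v) = 1" by blast
    have "\<forall>v\<in>V. 0 \<le> c v" using c(1) by (metis atLeastAtMost_iff)
    then show "x \<in> conv_hull n V" unfolding conv_hull_def using x c(2) by blast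
  next
    fix x assume "x \<in> conv_hull n V"
    then obtain c where x: "x = ?g c" and c: "\<forall>v\<in>V. 0 \<le> c v" "(\<Sum>v\<in>V. c v) = 1"
      unfolding conv_hull_def by blast
    let ?c = "\<lambda>v. if v \<in> V then c v else 0"
    have "c v \<le> 1" if "v \<in> V" for v
      using member_le_sum[of v V c] that c V by auto
    then have "?g ?c \<in> ?g ` ?S" using c by (intro imageI) auto
    moreover have "x = ?g ?c" unfolding x by (auto simp: fun_eq_iff intro!: sum.cong)
    ultimately show "x \<in> ?g ` ?S" by simp
  qed
  finally show ?thesis .
qed

text \<open>
  Points of \<open>real_space n\<close> have the default value in all coordinates from \<open>n\<close> on, so the inclusion into
  the full product of countably many lines is measurable, and there product and Borel sigma algebras
  agree.
\<close>

lemma compact_in_sets_leb: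
  assumes K: "compact K" "K \<subseteq> real_space n"
  shows "K \<in> sets (leb n)"
proof -
  have "(\<lambda>x i. x i) \<in> measurable (leb n) (\<Pi>\<^sub>M i\<in>UNIV. (borel :: real measure))"
  proof (rule measurable_PiM_single')
    fix i :: nat
    show "(\<lambda>x. x i) \<in> borel_measurable (leb n)"
    proof (cases "i < n")
      case False
      then have "(\<lambda>x. x i) \<in> borel_measurable (leb n) \<longleftrightarrow>
          (\<lambda>x. undefined :: real) \<in> borel_measurable (leb n)"
        by (intro measurable_cong) (auto simp: space_leb real_space_def PiE_iff extensional_def)
      then show ?thesis by simp
    qed (rule measurable_leb_component)
  qed auto
  moreover have "K \<in> sets (\<Pi>\<^sub>M i\<in>UNIV. (borel :: real measure))"
    using compact_imp_closed[OF K(1)] by (simp add: sets_PiM_equal_borel borel_closed)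
  ultimately have "(\<lambda>x i. x i) -` K \<inter> space (leb n) \<in> sets (leb n)"
    by (rule measurable_sets)
  also have "(\<lambda>x i. x i) -` K \<inter> space (leb n) = K" using K by (auto simp: space_leb)
  finally show ?thesis .
qed

lemma affine_function_conv_comb:
  assumes u: "affine_function n u" and c: "(\<Sum>v\<in>V. c v) = 1"
  shows "u (\<lambda>i\<in>{..<n}. \<Sum>v\<in>V. c v * v i) = (\<Sum>v\<in>V. c v * u v)"
proof -
  obtain a b where u: "u = (\<lambda>x. a + (\<Sum>i<n. b i * x i))"
    using u unfolding affine_function_def by blast
  have "(\<Sum>v\<in>V. c v * u v) = (\<Sum>v\<in>V. c v) * a + (\<Sum>v\<in>V. \<Sum>i<n. c v * (b i * v i))"
    by (simp add: u distrib_left sum.distrib sum_distrib_left sum_distrib_right)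
  also have "(\<Sum>v\<in>V. \<Sum>i<n. c v * (b i * v i)) = (\<Sum>i<n. \<Sum>v\<in>V. c v * (b i * v i))"
    by (rule sum.swap)
  also have "\<dots> = (\<Sum>i<n. b i * (\<Sum>v\<in>V. c v * v i))"
    by (simp add: sum_distrib_left mult.left_commute)
  finally show ?thesis by (simp add: u c)
qed

lemma vertex_in_conv_hull:
  assumes "finite V" "v \<in> V" "v \<in> real_space n"
  shows "v \<in> conv_hull n V"
proof -
  have "v = (\<lambda>i\<in>{..<n}. \<Sum>w\<in>V. (if w = v then 1 else 0) * w i)"
  proof
    fix i
    have "(\<Sum>w\<in>V. (if w = v then 1 else 0) * w i) = v i"
      using assms by (subst sum.remove[of _ v]) auto
    then show "v i = (\<lambda>i\<in>{..<n}. \<Sum>w\<in>V. (if w = v then 1 else 0) * w i) i"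
      using assms(3) by (auto simp: real_space_def PiE_iff extensional_def)
  qed
  moreover have "(\<Sum>w\<in>V. if w = v then 1 else (0::real)) = 1" using assms by simp
  ultimately show ?thesis
    unfolding conv_hull_def
    by (intro CollectI exI[of _ "\<lambda>w. if w = v then 1 else (0::real)"]) auto
qed

text \<open>At a convex combination an affine function takes a weighted average of its values at the vertices,
  so the best vertex is a maximizer.\<close>

lemma affine_function_max_on_conv_hull:
  assumes V: "finite V" "V \<noteq> {}" "V \<subseteq> real_space n" and u: "affine_function n u"
  shows "\<exists>x\<in>conv_hull n V. \<forall>y\<in>conv_hull n V. u y \<le> u x"
proof -
  have fin: "finite (u ` V)" "u ` V \<noteq> {}" using V by auto
  obtain v where v: "v \<in> V" "u v = Max (u ` V)" using Max_in[OF fin] by auto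
  have "u y \<le> u v" if hull: "y \<in> conv_hull n V" for y
  proof -
    obtain c where y: "y = (\<lambda>i\<in>{..<n}. \<Sum>v\<in>V. c v * v i)" and c: "\<forall>v\<in>V. 0 \<le> c v" "(\<Sum>v\<in>V. c v) = 1"
      using hull unfolding conv_hull_def by blast
    have "u y = (\<Sum>w\<in>V. c w * u w)" unfolding y by (rule affine_function_conv_comb[OF u c(2)])
    also have "\<dots> \<le> (\<Sum>w\<in>V. c w * u v)"
      using c(1) fin v by (intro sum_mono mult_left_mono) auto
    also have "\<dots> = u v" using c(2) by (simp add: sum_distrib_right[symmetric])
    finally show ?thesis .
  qed
  then show ?thesis using vertex_in_conv_hull[OF V(1) v(1)] v V by blast
qed

lemma interior_origin_contains_cube:
  assumes "origin n \<in> real_space_top n interior_of P"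
  shows "\<exists>e>0. ({..<n} \<rightarrow>\<^sub>E {-e..e}) \<subseteq> P"
proof -
  obtain T where T: "openin (real_space_top n) T" "origin n \<in> T" "T \<subseteq> P"
    using assms unfolding interior_of_def by blast
  have "\<exists>U. finite {i \<in> {..<n}. U i \<noteq> topspace euclideanreal} \<and>
      (\<forall>i\<in>{..<n}. openin euclideanreal (U i)) \<and> origin n \<in> Pi\<^sub>E {..<n} U \<and> Pi\<^sub>E {..<n} U \<subseteq> T"
    using T(1,2) unfolding real_space_top_def openin_product_topology_alt by (rule bspec)
  then obtain U where "\<forall>i\<in>{..<n}. openin euclideanreal (U i)"
    and U: "origin n \<in> Pi\<^sub>E {..<n} U" "Pi\<^sub>E {..<n} U \<subseteq> T" by blast
  then have open_U: "open (U i)" if "i < n" for i using that by simp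
  have "\<exists>e>0. {-e..e} \<subseteq> U i" if i: "i < n" for i
  proof -
    have "0 \<in> U i" using U(1) i by (auto simp: origin_def PiE_iff)
    then obtain e where e: "e > 0" "cball 0 e \<subseteq> U i"
      using open_U[OF i] open_contains_cball by blast
    then show ?thesis by (intro exI[of _ e]) (auto simp: cball_eq_atLeastAtMost)
  qed
  then obtain e where e: "\<And>i. i < n \<Longrightarrow> e i > 0" "\<And>i. i < n \<Longrightarrow> {-e i..e i} \<subseteq> U i" by metis
  \<comment> \<open>The element 1 keeps the set nonempty in dimension 0.\<close>
  define d where "d = Min (insert 1 (e ` {..<n}))"
  have "d > 0" unfolding d_def using e(1) by (subst Min_gr_iff) auto
  moreover have "d \<le> e i" if "i < n" for i unfolding d_def using that by (intro Min_le) auto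
  then have "({..<n} \<rightarrow>\<^sub>E {-d..d}) \<subseteq> Pi\<^sub>E {..<n} U"
    using e(2) by (intro PiE_mono) (force simp: subset_iff)
  then have "({..<n} \<rightarrow>\<^sub>E {-d..d}) \<subseteq> P" using U(2) T(3) by (rule order.trans[OF order.trans])
  ultimately show ?thesis by (intro exI conjI)
qed

lemma reflexive_polytope_affine_body:
  assumes "reflexive_polytope n P"
  shows "affine_body n P"
proof -
  obtain V where V: "finite V" "V \<subseteq> lattice_points n" "P = conv_hull n V"
    using assms unfolding reflexive_polytope_def lattice_polytope_def by blast
  have Vr: "V \<subseteq> real_space n" using V(2) by (auto simp: lattice_points_def real_space_def PiE_iff)
  have Pr: "P \<subseteq> real_space n" unfolding V(3) conv_hull_def real_space_def by (auto split: if_splits)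
  obtain e where e: "e > 0" "({..<n} \<rightarrow>\<^sub>E {-e..e}) \<subseteq> P"
    using assms interior_origin_contains_cube unfolding reflexive_polytope_def by blast
  have "origin n \<in> {..<n} \<rightarrow>\<^sub>E {-e..e}" using e(1) by (auto simp: origin_def)
  then have "origin n \<in> P" using e(2) by blast
  then have Vne: "V \<noteq> {}" by (auto simp: V(3) conv_hull_def)
  have max: "\<exists>x\<in>P. \<forall>y\<in>P. u y \<le> u x" if "affine_function n u" for u
    unfolding V(3) by (rule affine_function_max_on_conv_hull[OF V(1) Vne Vr that])
  have bound: "\<bar>x i\<bar> \<le> (\<Sum>v\<in>V. \<Sum>j<n. \<bar>v j\<bar>)" if hull: "x \<in> P" and i: "i < n" for x i
  proof -
    obtain c where x: "x = (\<lambda>i\<in>{..<n}. \<Sum>v\<in>V. c v * v i)" and c: "\<forall>v\<in>V. 0 \<le> c v" "(\<Sum>v\<in>V. c v) = 1"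
      using hull unfolding V(3) conv_hull_def by blast
    have "\<bar>x i\<bar> \<le> (\<Sum>v\<in>V. \<bar>c v * v i\<bar>)" using i by (simp add: x sum_abs)
    also have "\<dots> \<le> (\<Sum>v\<in>V. \<Sum>j<n. \<bar>v j\<bar>)"
    proof (rule sum_mono)
      fix v assume v: "v \<in> V"
      have "c v \<le> 1" using member_le_sum[of v V c] v c V(1) by auto
      then have "\<bar>c v * v i\<bar> \<le> \<bar>v i\<bar>"
        using c(1) v by (auto simp: abs_mult intro: mult_left_le_one_le)
      also have "\<dots> \<le> (\<Sum>j<n. \<bar>v j\<bar>)" using i by (intro member_le_sum) auto
      finally show "\<bar>c v * v i\<bar> \<le> (\<Sum>j<n. \<bar>v j\<bar>)" .
    qed
    finally show ?thesis .
  qed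
  have "P \<in> sets (leb n)"
    using compact_conv_hull[OF V(1), of n] Pr by (intro compact_in_sets_leb) (simp add: V(3))
  then show ?thesis
    unfolding affine_body_def
  proof (intro conjI allI impI)
    show "\<exists>B. \<forall>x\<in>P. \<forall>i<n. \<bar>x i\<bar> \<le> B" using bound by blast
    show "\<exists>e>0. ({..<n} \<rightarrow>\<^sub>E {-e..e}) \<subseteq> P" using e by (intro exI conjI)
  qed (auto intro: max)
qed

section \<open>Finite products\<close>

text \<open>The empty product, with which the induction starts, is a single point of volume 1. There the Ricci
  affine function is 1 and the potential vanishes.\<close>

lemma dimension_zero:
  "affine_body 0 (real_space 0)" "mabuchi_constant 0 (real_space 0) = 0"
proof -
  have box: "emeasure (leb 0) (real_space 0) = 1" using emeasure_leb_box[of 0] by (simp add: real_space_def)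
  show body: "affine_body 0 (real_space 0)"
    unfolding affine_body_def
    using sets.top[of "leb 0"] by (auto simp: space_leb real_space_def intro!: exI[of _ "1::real"])
  have "represents_origin 0 (real_space 0) (\<lambda>_. 1)"
    unfolding represents_origin_def
  proof (intro conjI allI impI affine_function_const)
    fix u assume "affine_function 0 u"
    then obtain a where u: "u = (\<lambda>_. a)" by (auto simp: affine_function_def)
    have "(LINT x:real_space 0|leb 0. a * 1) = a"
      by (simp only: set_integral_mult_right set_integral_one[OF body]) (simp add: measure_def box)
    then show "(LINT x:real_space 0|leb 0. 1 * u x) = u (origin 0)" by (simp add: u)
  qed
  then have "potential 0 (real_space 0) x = 0" for x
    by (simp add: potential_def ricci_affine_eq[OF body] measure_def box)
  moreover obtain x where "mabuchi_constant 0 (real_space 0) = potential 0 (real_space 0) x"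
    using mabuchi_constant_attained[OF body] by blast
  ultimately show "mabuchi_constant 0 (real_space 0) = 0" by simp
qed

text \<open>Blocks up to the \<open>r\<close>-th lie within the first \<open>n 1 + \<dots> + n r\<close> coordinates, so they can be read off
  the prefix, and the last block is the suffix.\<close>

lemma product_polytope_Suc:
  "product_polytope (Suc r) n P =
    product_body (\<Sum>k=1..r. n k) (n (Suc r)) (product_polytope r n P) (P (Suc r))"
proof -
  let ?N = "\<Sum>k=1..r. n k"
  have suf: "block n (Suc r) x = suffix ?N (n (Suc r)) x" for x
    by (simp add: block_def suffix_def atLeastLessThanSuc_atLeastAtMost)
  have blk: "block n k (prefix ?N x) = block n k x" if k: "k \<in> {1..r}" for k x
  proof -
    have "(\<Sum>j=1..<k. n j) + i < ?N" if "i < n k" for i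
    proof -
      have "(\<Sum>j=1..<k. n j) + n k = (\<Sum>j=1..k. n j)" using k by (simp add: sum.last_plus add.commute)
      also have "\<dots> \<le> ?N" using k by (intro sum_mono2) auto
      finally show ?thesis using that by linarith
    qed
    then show ?thesis by (auto simp: block_def prefix_def fun_eq_iff)
  qed
  have pre: "prefix ?N x \<in> real_space ?N" for x by (auto simp: prefix_def real_space_def)
  have "{1..Suc r} = insert (Suc r) {1..r}" by auto
  then show ?thesis
    using blk pre by (auto simp: product_polytope_def product_body_def suf add.commute[of "n (Suc r)" "sum n {Suc 0..r}"])
qed

lemma product_polytope_body_and_mabuchi:
  assumes "\<And>k. k \<in> {1..r} \<Longrightarrow> affine_body (n k) (P k)"
  shows "affine_body (\<Sum>k=1..r. n k) (product_polytope r n P) \<and>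
    mabuchi_constant (\<Sum>k=1..r. n k) (product_polytope r n P) = (\<Sum>k=1..r. mabuchi_constant (n k) (P k))"
  using assms
proof (induction r)
  case 0
  have "product_polytope 0 n P = real_space 0" by (simp add: product_polytope_def)
  then show ?case using dimension_zero by simp
next
  case (Suc r)
  then have "affine_body (n (Suc r)) (P (Suc r))" and
    IH: "affine_body (\<Sum>k=1..r. n k) (product_polytope r n P)"
      "mabuchi_constant (\<Sum>k=1..r. n k) (product_polytope r n P) = (\<Sum>k=1..r. mabuchi_constant (n k) (P k))"
    by auto
  then show ?case
    using affine_body_product[OF IH(1)] mabuchi_constant_product[OF IH(1)]
    by (simp add: product_polytope_Suc)
qed

theorem proposition1p5:
  fixes r :: nat and n :: "nat \<Rightarrow> nat" and \<Delta> :: "nat \<Rightarrow> point set"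
  assumes "\<And>k. k \<in> {1..r} \<Longrightarrow> reflexive_polytope (n k) (\<Delta> k)"
  shows "mabuchi_constant (\<Sum>k=1..r. n k) (product_polytope r n \<Delta>) =
         (\<Sum>k=1..r. mabuchi_constant (n k) (\<Delta> k))"
proof -
  have "affine_body (n k) (\<Delta> k)" if "k \<in> {1..r}" for k
    using that by (intro reflexive_polytope_affine_body assms)
  then show ?thesis using product_polytope_body_and_mabuchi[of r n \<Delta>] by simp
qed

end
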